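(* Let $k\ge 1$ and let $\mathbf{w}=(w_1,\dots,w_k)$, where each $w_i$ is a (possibly empty) positive word on the letters $a_1,\dots,a_{i-1}$, and suppose that $\mathbf{w}=(1,\dots,1,w_c,\dots,w_k)$ with $w_c\ne 1$ (so $w_i=1$ for $i<c$). Let $\mathbf{r}=(r_1,\dots,r_k)$ be a tuple of integers $r_i\ge 0$. Let $$G_k(\mathbf{w})=\langle a_1,\dots,a_k,t\mid a_i^t=a_iw_i,\ 1\le i\le k\rangle,\qquad H_k(\mathbf{r})=\langle a_1t^{r_1},\dots,a_kt^{r_k}\rangle\le G_k(\mathbf{w}).$$ Let $[w_c]_i$ denote the index sum of $a_i$ in $w_c$. If $$\sum_{i=1}^{c-1}[w_c]_i\,r_i\ne 0,$$ then $H_k(\mathbf{r})$ is a non-separable subgroup of $G_k(\mathbf{w})$.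
   Context: Convention: $a^b:=b^{-1}ab$. A positive word is a word with no inverse letters; $1$ denotes the empty word. The index sum of $a_i$ in a word is the sum of the exponents of the occurrences of $a_i$ in it. A subgroup $H\le G$ is separable in $G$ if for every $g\in G\setminus H$ there is a homomorphism $\phi$ from $G$ onto a finite group with $\phi(g)\notin\phi(H)$; otherwise it is non-separable. *)

theory Defs
  imports "HOL-Algebra.Generated_Groups"
begin

section \<open>Words and group presentations\<close>

text \<open>
  A group word is a list of signed letters: \<open>(x, True)\<close> is the letter \<open>x\<close> and
  \<open>(x, False)\<close> is its formal inverse.
\<close>

type_synonym 'a gword = "('a \<times> bool) list"

definition gwords :: "'a set \<Rightarrow> 'a gword set" where
  "gwords X = {u. fst ` set u \<subseteq> X}"

definition positive_word :: "'a gword \<Rightarrow> bool" where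
  "positive_word u \<longleftrightarrow> (\<forall>(x, e) \<in> set u. e)"

definition word_inv :: "'a gword \<Rightarrow> 'a gword" where
  "word_inv u = rev (map (\<lambda>(x, e). (x, \<not> e)) u)"

text \<open>The convention for exponents is \<open>u\<^sup>v = v\<^sup>-\<^sup>1 u v\<close>.\<close>

definition word_conj :: "'a gword \<Rightarrow> 'a gword \<Rightarrow> 'a gword" where
  "word_conj u v = word_inv v @ u @ v"

definition index_sum :: "'a \<Rightarrow> 'a gword \<Rightarrow> int" where
  "index_sum x u = (\<Sum>(y, e) \<leftarrow> u. if y = x then (if e then 1 else - 1) else 0)"

text \<open>
  For a set \<open>R\<close> of relations \<open>l = r\<close>, given as pairs of words, \<open>pres_eq X R\<close> is the least
  congruence on the monoid of words over \<open>X\<close> that contains \<open>R\<close> and cancels adjacent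
  mutually inverse letters. The quotient is the group \<open>\<langle>X | R\<rangle>\<close>.
\<close>

inductive pres_eq :: "'a set \<Rightarrow> ('a gword \<times> 'a gword) set \<Rightarrow> 'a gword \<Rightarrow> 'a gword \<Rightarrow> bool"
  for X R where
  refl: "u \<in> gwords X \<Longrightarrow> pres_eq X R u u"
| sym: "pres_eq X R u v \<Longrightarrow> pres_eq X R v u"
| trans: "pres_eq X R u v \<Longrightarrow> pres_eq X R v w \<Longrightarrow> pres_eq X R u w"
| mult: "pres_eq X R u v \<Longrightarrow> pres_eq X R u' v' \<Longrightarrow> pres_eq X R (u @ u') (v @ v')"
| cancel: "x \<in> X \<Longrightarrow> pres_eq X R [(x, e), (x, \<not> e)] []"
| rel: "(l, r) \<in> R \<Longrightarrow> l \<in> gwords X \<Longrightarrow> r \<in> gwords X \<Longrightarrow> pres_eq X R l r"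

definition pres_class :: "'a set \<Rightarrow> ('a gword \<times> 'a gword) set \<Rightarrow> 'a gword \<Rightarrow> 'a gword set" where
  "pres_class X R u = {v. pres_eq X R u v}"

definition presented_group ::
  "'a set \<Rightarrow> ('a gword \<times> 'a gword) set \<Rightarrow> 'a gword set monoid" where
  "presented_group X R =
    \<lparr>carrier = pres_class X R ` gwords X,
     mult = (\<lambda>P Q. \<Union>p\<in>P. \<Union>q\<in>Q. pres_class X R (p @ q)),
     one = pres_class X R []\<rparr>"

lemma gwords_simps [simp]:
  "[] \<in> gwords X"
  "u @ v \<in> gwords X \<longleftrightarrow> u \<in> gwords X \<and> v \<in> gwords X"
  "p # u \<in> gwords X \<longleftrightarrow> fst p \<in> X \<and> u \<in> gwords X"
  by (auto simp: gwords_def)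

lemma word_inv_simps [simp]:
  "word_inv [] = []"
  "word_inv (u @ v) = word_inv v @ word_inv u"
  "word_inv ((x, e) # u) = word_inv u @ [(x, \<not> e)]"
  by (auto simp: word_inv_def)

lemma word_inv_gwords [simp]: "word_inv u \<in> gwords X \<longleftrightarrow> u \<in> gwords X"
  by (force simp: word_inv_def gwords_def)

lemma pres_eq_gwords:
  assumes "pres_eq X R u v"
  shows "u \<in> gwords X \<and> v \<in> gwords X"
  using assms by induction auto

lemma pres_class_eq_iff:
  assumes "u \<in> gwords X"
  shows "pres_class X R u = pres_class X R v \<longleftrightarrow> pres_eq X R u v"
proof
  assume "pres_class X R u = pres_class X R v"
  moreover have "u \<in> pres_class X R u"
    using assms by (simp add: pres_class_def pres_eq.refl)
  ultimately show "pres_eq X R u v"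
    by (simp add: pres_class_def pres_eq.sym)
next
  assume uv: "pres_eq X R u v"
  have "pres_eq X R u x \<longleftrightarrow> pres_eq X R v x" for x
    using pres_eq.trans[OF uv, of x] pres_eq.trans[OF pres_eq.sym[OF uv], of x] by blast
  then show "pres_class X R u = pres_class X R v"
    by (simp add: pres_class_def)
qed

lemma pres_mult_class:
  assumes "u \<in> gwords X" "v \<in> gwords X"
  shows "pres_class X R u \<otimes>\<^bsub>presented_group X R\<^esub> pres_class X R v = pres_class X R (u @ v)"
proof -
  have eq: "pres_class X R (p @ q) = pres_class X R (u @ v)"
    if "p \<in> pres_class X R u" "q \<in> pres_class X R v" for p q
  proof -
    have "pres_eq X R (u @ v) (p @ q)"
      using that by (simp add: pres_class_def pres_eq.mult)
    then show ?thesis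
      using pres_class_eq_iff[of "u @ v" X R "p @ q"] assms by simp
  qed
  have "u \<in> pres_class X R u" "v \<in> pres_class X R v"
    using assms by (simp_all add: pres_class_def pres_eq.refl)
  then have ne: "pres_class X R u \<noteq> {}" "pres_class X R v \<noteq> {}"
    by blast+
  have "(\<Union>p\<in>pres_class X R u. \<Union>q\<in>pres_class X R v. pres_class X R (p @ q))
      = (\<Union>p\<in>pres_class X R u. \<Union>q\<in>pres_class X R v. pres_class X R (u @ v))"
    by (simp add: eq cong: SUP_cong)
  also have "\<dots> = pres_class X R (u @ v)"
    using ne by simp
  finally show ?thesis
    by (simp add: presented_group_def)
qed

lemma pres_eq_word_inv:
  assumes "u \<in> gwords X"
  shows "pres_eq X R (word_inv u @ u) []"
  using assms
proof (induction u)
  case Nil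
  then show ?case by (simp add: pres_eq.refl)
next
  case (Cons p u)
  obtain x e where p: "p = (x, e)" by (cases p)
  have x: "x \<in> X" and u: "u \<in> gwords X" using Cons.prems p by auto
  have r: "pres_eq X R u u" "pres_eq X R (word_inv u) (word_inv u)"
    using u by (simp_all add: pres_eq.refl)
  have "pres_eq X R ([(x, \<not> e), (x, e)] @ u) ([] @ u)"
    using pres_eq.mult[OF pres_eq.cancel[OF x, of R "\<not> e"] r(1)] by simp
  from pres_eq.mult[OF r(2) this] have "pres_eq X R (word_inv u @ [(x, \<not> e), (x, e)] @ u) (word_inv u @ [] @ u)"
    .
  then show ?case using pres_eq.trans[OF _ Cons.IH[OF u]] p by simp
qed

lemma group_presented_group: "group (presented_group X R)"
proof (rule groupI)
  let ?G = "presented_group X R"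
  have car: "carrier ?G = pres_class X R ` gwords X" and one: "\<one>\<^bsub>?G\<^esub> = pres_class X R []"
    by (auto simp: presented_group_def)
  show "\<one>\<^bsub>?G\<^esub> \<in> carrier ?G" by (auto simp: car one)
  show "P \<otimes>\<^bsub>?G\<^esub> Q \<in> carrier ?G" if "P \<in> carrier ?G" "Q \<in> carrier ?G" for P Q
    using that by (auto simp: car pres_mult_class)
  show "P \<otimes>\<^bsub>?G\<^esub> Q \<otimes>\<^bsub>?G\<^esub> S = P \<otimes>\<^bsub>?G\<^esub> (Q \<otimes>\<^bsub>?G\<^esub> S)"
    if "P \<in> carrier ?G" "Q \<in> carrier ?G" "S \<in> carrier ?G" for P Q S
    using that by (auto simp: car pres_mult_class)
  show "\<one>\<^bsub>?G\<^esub> \<otimes>\<^bsub>?G\<^esub> P = P" if "P \<in> carrier ?G" for P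
    using that by (auto simp: car one pres_mult_class)
  show "\<exists>Q\<in>carrier ?G. Q \<otimes>\<^bsub>?G\<^esub> P = \<one>\<^bsub>?G\<^esub>" if P: "P \<in> carrier ?G" for P
  proof -
    obtain u where u: "u \<in> gwords X" "P = pres_class X R u" using P unfolding car by blast
    have "pres_class X R (word_inv u) \<otimes>\<^bsub>?G\<^esub> P = \<one>\<^bsub>?G\<^esub>"
      using u pres_eq_word_inv[OF u(1), of R] by (simp add: one pres_mult_class pres_class_eq_iff)
    moreover have "pres_class X R (word_inv u) \<in> carrier ?G" using u by (auto simp: car)
    ultimately show ?thesis by blast
  qed
qed


section \<open>Separable subgroups\<close>

text \<open>
  The finite quotient is taken with carrier in \<open>nat\<close>, because HOL cannot quantify over types
  inside a formula. As every finite group is isomorphic to one of these, nothing is lost: see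
  \<open>finite_quotient_nat\<close> below.
\<close>

definition separable :: "('a, 'b) monoid_scheme \<Rightarrow> 'a set \<Rightarrow> bool" where
  "separable G H \<longleftrightarrow>
    (\<forall>g \<in> carrier G - H. \<exists>(Q :: nat monoid) \<phi>.
       group Q \<and> finite (carrier Q) \<and> \<phi> \<in> epi G Q \<and> \<phi> g \<notin> \<phi> ` H)"

lemma finite_quotient_nat:
  fixes G :: "('a, 'b) monoid_scheme" and Q :: "('c, 'd) monoid_scheme"
  assumes G: "group G" and Q: "group Q" "finite (carrier Q)" and \<phi>: "\<phi> \<in> epi G Q"
    and H: "H \<subseteq> carrier G" and g: "g \<in> carrier G" "\<phi> g \<notin> \<phi> ` H"
  shows "\<exists>(Q' :: nat monoid) \<psi>.
    group Q' \<and> finite (carrier Q') \<and> \<psi> \<in> epi G Q' \<and> \<psi> g \<notin> \<psi> ` H"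
proof -
  interpret Q: group Q by (rule Q)
  obtain f :: "'c \<Rightarrow> nat" where f: "inj_on f (carrier Q)"
    using finite_imp_inj_to_nat_seg[OF Q(2)] by blast
  define h where "h = inv_into (carrier Q) f"
  have h [simp]: "h (f x) = x" if "x \<in> carrier Q" for x
    using f that by (simp add: h_def)
  define Q' :: "nat monoid" where
    "Q' = \<lparr>carrier = f ` carrier Q, mult = (\<lambda>x y. f (h x \<otimes>\<^bsub>Q\<^esub> h y)), one = f \<one>\<^bsub>Q\<^esub>\<rparr>"
  have "group Q'"
  proof (rule groupI)
    fix x assume "x \<in> carrier Q'"
    then obtain y where y: "y \<in> carrier Q" "x = f y" by (auto simp: Q'_def)
    have "f (inv\<^bsub>Q\<^esub> y) \<otimes>\<^bsub>Q'\<^esub> x = \<one>\<^bsub>Q'\<^esub>" "f (inv\<^bsub>Q\<^esub> y) \<in> carrier Q'"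
      using y by (auto simp: Q'_def)
    then show "\<exists>y\<in>carrier Q'. y \<otimes>\<^bsub>Q'\<^esub> x = \<one>\<^bsub>Q'\<^esub>" by blast
  qed (auto simp: Q'_def Q.m_assoc)
  moreover have "finite (carrier Q')" using Q by (simp add: Q'_def)
  moreover have \<phi>_car: "\<phi> x \<in> carrier Q" if "x \<in> carrier G" for x
    using \<phi> that by (auto simp: epi_def hom_def)
  moreover have "f \<circ> \<phi> \<in> epi G Q'"
  proof -
    have "\<phi> ` carrier G = carrier Q" using \<phi> by (simp add: epi_def)
    then have "f ` \<phi> ` carrier G = f ` carrier Q" by (rule arg_cong)
    then have "(f \<circ> \<phi>) ` carrier G = carrier Q'" by (simp add: Q'_def image_comp)
    moreover have "f \<circ> \<phi> \<in> hom G Q'"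
      using \<phi> \<phi>_car by (auto simp: epi_def hom_def Q'_def)
    ultimately show ?thesis by (simp add: epi_def)
  qed
  moreover have "(f \<circ> \<phi>) g \<notin> (f \<circ> \<phi>) ` H"
    using inj_on_eq_iff[OF f] \<phi>_car H g by (auto simp: subset_iff image_iff)
  ultimately show ?thesis by blast
qed


section \<open>The groups \<open>G\<^sub>k(w)\<close> and the subgroups \<open>H\<^sub>k(r)\<close>\<close>

datatype letter = A nat | T

text \<open>
  Tuples indexed by \<open>1, \<dots>, k\<close> are functions on \<open>nat\<close>; only their values on \<open>{1..k}\<close> are used.
\<close>

definition Gk_gens :: "nat \<Rightarrow> letter set" where
  "Gk_gens k = insert T (A ` {1..k})"

definition Gk_rels :: "nat \<Rightarrow> (nat \<Rightarrow> letter gword) \<Rightarrow> (letter gword \<times> letter gword) set" where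
  "Gk_rels k w =
    (\<lambda>i. (word_conj [(A i, True)] [(T, True)], (A i, True) # w i)) ` {1..k}"

definition Gk :: "nat \<Rightarrow> (nat \<Rightarrow> letter gword) \<Rightarrow> letter gword set monoid" where
  "Gk k w = presented_group (Gk_gens k) (Gk_rels k w)"

definition Hk :: "nat \<Rightarrow> (nat \<Rightarrow> letter gword) \<Rightarrow> (nat \<Rightarrow> nat) \<Rightarrow> letter gword set set" where
  "Hk k w r = generate (Gk k w)
    ((\<lambda>i. pres_class (Gk_gens k) (Gk_rels k w) ((A i, True) # replicate (r i) (T, True))) ` {1..k})"

end

theory Submission
  imports Defs "HOL-Library.Countable_Set"
begin

text \<open>
  Put \<open>b = a\<^sub>c t\<^bsup>r c\<^esup>\<close> and let \<open>W\<close> be \<open>w\<^sub>c\<close> evaluated at the generators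
  \<open>a\<^sub>j t\<^bsup>r j\<^esup>\<close> of \<open>H\<close>; both lie in \<open>H\<close>. As \<open>t\<close> commutes with \<open>a\<^sub>1, \<dots>, a\<^bsub>c-1\<^esub>\<close>, it commutes
  with \<open>W\<close>, and \<open>t b W = b t\<^bsup>1 + s\<^esup>\<close> with \<open>s = \<Sum>\<^sub>j [w\<^sub>c]\<^sub>j r\<^sub>j > 0\<close>. Hence \<open>H t\<^sup>n b = H t\<^bsup>(1 + s) n\<^esup>\<close>.
  In a finite quotient, right multiplication by \<open>b\<close> permutes the cosets \<open>H t\<^sup>n\<close>, so
  \<open>H t b\<^sup>-\<^sup>1\<close> is one of them and is fixed by \<open>W\<close>: the image of \<open>g = t b\<^sup>-\<^sup>1 W b t\<^sup>-\<^sup>1\<close> lies in the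
  image of \<open>H\<close>.

  That \<open>g\<close> is not in \<open>H\<close> is seen in a permutation representation in which \<open>H\<close> fixes a point
  that \<open>g\<close> moves. It starts with two infinite \<open>t\<close>-orbits and is extended one letter \<open>a\<^sub>i\<close> at a
  time. The permutation \<open>a\<^sub>i\<close> has to conjugate \<open>t\<close> to \<open>t w\<^sub>i\<^sup>-\<^sup>1\<close> and is prescribed on the orbit of
  the base point \<open>z\<^sub>0 = z 0\<close>, where \<open>z\<^sub>0 a\<^sub>i = z\<^sub>0 t\<^bsup>- r i\<^esup>\<close>. This is consistent because positive words
  and \<open>t\<^sup>-\<^sup>1\<close> act on the negative half of that orbit, so that the orbit of \<open>z\<^sub>0 a\<^sub>i\<close> under \<open>t w\<^sub>i\<^sup>-\<^sup>1\<close>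
  is infinite too.
\<close>

section \<open>Finite quotients\<close>

lemma (in group) conj_mem_of_finite:
  assumes fin: "finite (carrier G)" and K: "subgroup K G"
    and b: "b \<in> K" and W: "W \<in> K" and t: "t \<in> carrier G"
    and comm: "t \<otimes> W = W \<otimes> t" and rel: "t \<otimes> b \<otimes> W = b \<otimes> t [^] (u::nat)"
  shows "t \<otimes> inv b \<otimes> W \<otimes> b \<otimes> inv t \<in> K"
proof -
  interpret K: subgroup K G by (rule K)
  have [simp]: "b \<in> carrier G" "W \<in> carrier G" "t \<in> carrier G"
    using b W t K.mem_carrier by auto
  have KG [simp]: "x \<in> carrier G" if "x \<in> K" for x
    using that K.mem_carrier by auto
  have WK: "W [^] (n::nat) \<in> K" for n
    using W by (induction n) simp_all
  have tW: "t [^] (n::nat) \<otimes> W = W \<otimes> t [^] n" for n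
    using comm by (simp add: pow_mult_distrib group_commutes_pow)
  have tn: "t [^] n \<otimes> b \<otimes> W [^] n = b \<otimes> t [^] (u * n)" for n :: nat
  proof (induction n)
    case (Suc n)
    have "t [^] Suc n \<otimes> b \<otimes> W [^] Suc n = t \<otimes> (t [^] n \<otimes> b \<otimes> W [^] n) \<otimes> W"
      by (simp only: nat_pow_Suc2[OF t]) (simp add: m_assoc)
    also have "\<dots> = t \<otimes> b \<otimes> W \<otimes> t [^] (u * n)"
      using tW[of "u * n"] by (simp add: Suc m_assoc)
    also have "\<dots> = b \<otimes> t [^] (u * Suc n)"
      by (simp add: rel m_assoc nat_pow_mult)
    finally show ?case .
  qed simp
  \<comment> \<open>A union of right cosets of \<open>K\<close>, in general no subgroup. Natural
    exponents are enough because \<open>u\<close> is one: \<open>t [^] n \<otimes> b\<close> lies in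
    a coset \<open>K t^(u n)\<close>.\<close>
  define M where "M = {k \<otimes> t [^] n |k (n::nat). k \<in> K}"
  have "(\<lambda>x. x \<otimes> b) ` M \<subseteq> M"
  proof clarify
    fix x assume "x \<in> M"
    then obtain k and n :: nat where k: "k \<in> K" and x: "x = k \<otimes> t [^] n"
      by (auto simp: M_def)
    have "t [^] n \<otimes> b = b \<otimes> t [^] (u * n) \<otimes> inv (W [^] n)"
      using tn[of n] by (simp add: inv_solve_right)
    also have "\<dots> = b \<otimes> inv (W [^] n) \<otimes> t [^] (u * n)"
    proof -
      have "t [^] (u * n) \<otimes> W [^] n = W [^] n \<otimes> t [^] (u * n)"
        using group_commutes_pow[OF tW[symmetric, of "u * n"], of n] by simp
      then have "inv (W [^] n) \<otimes> (t [^] (u * n) \<otimes> W [^] n) \<otimes> inv (W [^] n)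
          = inv (W [^] n) \<otimes> (W [^] n \<otimes> t [^] (u * n)) \<otimes> inv (W [^] n)"
        by simp
      then have "t [^] (u * n) \<otimes> inv (W [^] n) = inv (W [^] n) \<otimes> t [^] (u * n)"
        by (simp only: m_assoc[symmetric] nat_pow_closed inv_closed m_closed l_inv l_one \<open>W \<in> carrier G\<close> t)
          (simp add: m_assoc)
      then show ?thesis by (simp add: m_assoc)
    qed
    finally have "x \<otimes> b = (k \<otimes> (b \<otimes> inv (W [^] n))) \<otimes> t [^] (u * n)"
      using k x by (simp add: m_assoc)
    moreover have "k \<otimes> (b \<otimes> inv (W [^] n)) \<in> K"
      using k b WK[of n] by simp
    ultimately show "x \<otimes> b \<in> M" by (auto simp: M_def)
  qed
  moreover have "M \<subseteq> carrier G" by (auto simp: M_def)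
  then have "inj_on (\<lambda>x. x \<otimes> b) M" "finite M"
    using fin by (auto intro!: inj_onI intro: finite_subset simp: subset_iff)
  \<comment> \<open>An injective self-map of the finite set \<open>M\<close> is onto, so
    \<open>t\<close>, lying in \<open>M\<close>, can be divided by \<open>b\<close> inside
    \<open>M\<close>. Finiteness enters here.\<close>
  ultimately have "(\<lambda>x. x \<otimes> b) ` M = M" by (simp add: endo_inj_surj)
  moreover have "t \<in> M"
    unfolding M_def using K.one_closed by (auto intro!: exI[of _ \<one>] exI[of _ "1::nat"])
  ultimately have "t \<in> (\<lambda>x. x \<otimes> b) ` M" by simp
  then obtain x where x: "x \<in> M" and tx: "t = x \<otimes> b" by (rule imageE)
  obtain k and n :: nat where k: "k \<in> K" and kn: "x = k \<otimes> t [^] n"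
    using x by (auto simp: M_def)
  have "x \<in> carrier G" using k by (simp add: kn)
  then have tb: "t \<otimes> inv b = k \<otimes> t [^] n"
    using inv_solve_right[of x t b] tx unfolding kn by simp
  have "t \<otimes> inv b \<otimes> W \<otimes> b \<otimes> inv t = (t \<otimes> inv b) \<otimes> W \<otimes> inv (t \<otimes> inv b)"
    by (simp add: inv_mult_group m_assoc)
  also have "\<dots> = k \<otimes> (t [^] n \<otimes> W) \<otimes> inv (t [^] n) \<otimes> inv k"
    using k by (simp add: tb inv_mult_group m_assoc)
  also have "\<dots> = k \<otimes> W \<otimes> inv k"
    using k by (simp add: tW m_assoc inv_solve_right)
  finally show ?thesis using k W by simp
qed


section \<open>Actions of words\<close>

text \<open>Words act from the right: the leftmost letter acts first.\<close>

definition word_act :: "('x \<Rightarrow> 'a \<Rightarrow> 'a) \<Rightarrow> 'x gword \<Rightarrow> 'a \<Rightarrow> 'a" where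
  "word_act \<rho> = fold (\<lambda>(x, e). if e then \<rho> x else inv_into UNIV (\<rho> x))"

lemma word_act_simps [simp]:
  "word_act \<rho> [] p = p"
  "word_act \<rho> ((x, e) # u) p = word_act \<rho> u (if e then \<rho> x p else inv_into UNIV (\<rho> x) p)"
  "word_act \<rho> (u @ v) p = word_act \<rho> v (word_act \<rho> u p)"
  by (simp_all add: word_act_def)

lemma bij_word_act:
  assumes "\<And>x. bij (\<rho> x)"
  shows "bij (word_act \<rho> u)"
proof (induction u)
  case Nil
  have "word_act \<rho> [] = id" by (simp add: fun_eq_iff)
  then show ?case by (metis bij_id)
next
  case (Cons p u)
  obtain x e where p: "p = (x, e)" by (cases p)
  have "word_act \<rho> (p # u) = word_act \<rho> u \<circ> (if e then \<rho> x else inv_into UNIV (\<rho> x))"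
    by (simp add: fun_eq_iff p)
  moreover have "bij (if e then \<rho> x else inv_into UNIV (\<rho> x))"
    using assms[of x] by (simp add: bij_imp_bij_inv)
  ultimately show ?case using Cons.IH by (simp only: bij_comp)
qed

text \<open>Carries the values of words from one stage of the construction to the next. For an
  inverse letter, the intertwining relation is applied at the preimage under \<open>\<rho> x\<close>
  and the bijection \<open>\<rho>' x\<close> is cancelled.\<close>

lemma word_act_embed:
  assumes "\<And>x. bij (\<rho> x)" "\<And>x. bij (\<rho>' x)"
    and "\<And>x p. x \<in> fst ` set u \<Longrightarrow> \<rho>' x (\<iota> p) = \<iota> (\<rho> x p)"
  shows "word_act \<rho>' u (\<iota> p) = \<iota> (word_act \<rho> u p)"
  using assms(3)
proof (induction u arbitrary: p)
  case (Cons q u)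
  obtain x e where q: "q = (x, e)" by (cases q)
  have x: "\<rho>' x (\<iota> p) = \<iota> (\<rho> x p)" for p using Cons.prems q by simp
  have "inv_into UNIV (\<rho>' x) (\<iota> p) = \<iota> (inv_into UNIV (\<rho> x) p)"
    using x[of "inv_into UNIV (\<rho> x) p"] assms(1,2) by (metis bij_inv_eq_iff)
  then show ?case using Cons x q by simp
qed simp

lemma word_act_pres_eq:
  assumes "pres_eq X R u v" and bij: "\<And>x. bij (\<rho> x)"
    and rel: "\<And>l r p. (l, r) \<in> R \<Longrightarrow> word_act \<rho> l p = word_act \<rho> r p"
  shows "word_act \<rho> u p = word_act \<rho> v p"
  using assms(1)
proof (induction arbitrary: p)
  case (cancel x e)
  have "\<rho> x (inv_into UNIV (\<rho> x) q) = q" "inv_into UNIV (\<rho> x) (\<rho> x q) = q" for q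
    using bij[of x] by (simp_all add: bij_is_surj surj_f_inv_f bij_is_inj)
  then show ?case by simp
qed (simp_all add: rel)

lemma word_act_word_inv:
  assumes bij: "\<And>x. bij (\<rho> x)"
  shows "word_act \<rho> (word_inv u) (word_act \<rho> u p) = p"
proof (induction u arbitrary: p)
  case (Cons q u)
  obtain x e where q: "q = (x, e)" by (cases q)
  have "\<rho> x (inv_into UNIV (\<rho> x) q) = q" "inv_into UNIV (\<rho> x) (\<rho> x q) = q" for q
    using bij[of x] by (simp_all add: bij_is_surj surj_f_inv_f bij_is_inj)
  then show ?case using Cons q by simp
qed simp

section \<open>Presented groups and point stabilizers\<close>

lemma pres_class_in_carrier:
  "u \<in> gwords X \<Longrightarrow> pres_class X R u \<in> carrier (presented_group X R)"
  by (simp add: presented_group_def)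

lemma one_presented_group: "\<one>\<^bsub>presented_group X R\<^esub> = pres_class X R []"
  by (simp add: presented_group_def)

lemma pres_inv_class:
  assumes "u \<in> gwords X"
  shows "inv\<^bsub>presented_group X R\<^esub> pres_class X R u = pres_class X R (word_inv u)"
proof -
  interpret group "presented_group X R" by (rule group_presented_group)
  have "pres_class X R (word_inv u) \<otimes>\<^bsub>presented_group X R\<^esub> pres_class X R u
      = \<one>\<^bsub>presented_group X R\<^esub>"
    using assms pres_eq_word_inv[OF assms, of R]
    by (simp add: pres_mult_class pres_class_eq_iff one_presented_group)
  then show ?thesis
    using assms by (intro inv_equality) (simp_all add: pres_class_in_carrier)
qed

text \<open>Point stabilizers are subgroups, but the action is given on words, not on classes. So
  every class in the generated subgroup is shown to contain a word fixing \<open>p\<close>, and the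
  defining relations transfer this to \<open>g\<close>.\<close>

lemma generate_pres_class_fixes:
  assumes S: "S \<subseteq> gwords X" and bij: "\<And>x. bij (\<rho> x)"
    and rel: "\<And>l r p. (l, r) \<in> R \<Longrightarrow> word_act \<rho> l p = word_act \<rho> r p"
    and fix_p: "\<And>u. u \<in> S \<Longrightarrow> word_act \<rho> u p = p"
    and g: "g \<in> gwords X" "pres_class X R g \<in> generate (presented_group X R) (pres_class X R ` S)"
  shows "word_act \<rho> g p = p"
proof -
  have "\<exists>u\<in>gwords X. P = pres_class X R u \<and> word_act \<rho> u p = p"
    if "P \<in> generate (presented_group X R) (pres_class X R ` S)" for P
    using that
  proof induction
    case one
    then show ?case by (intro bexI[of _ "[]"]) (simp_all add: one_presented_group)
  next
    case (incl h)
    then show ?case using S fix_p by blast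
  next
    case (inv h)
    then obtain u where u: "u \<in> S" "h = pres_class X R u" by blast
    have "word_act \<rho> (word_inv u) p = p"
      using word_act_word_inv[of \<rho> u p, OF bij] fix_p[OF u(1)] by simp
    then show ?case using u S by (intro bexI[of _ "word_inv u"]) (auto simp: pres_inv_class)
  next
    case (eng h1 h2)
    then obtain u v where "u \<in> gwords X" "h1 = pres_class X R u" "word_act \<rho> u p = p"
      "v \<in> gwords X" "h2 = pres_class X R v" "word_act \<rho> v p = p" by blast
    then show ?case by (intro bexI[of _ "u @ v"]) (simp_all add: pres_mult_class)
  qed
  from this[OF g(2)] obtain u where "u \<in> gwords X" "pres_class X R g = pres_class X R u"
    "word_act \<rho> u p = p" by blast
  then show ?thesis
    using word_act_pres_eq[of X R g u \<rho> p, OF _ bij rel] g(1)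
    by (simp add: pres_class_eq_iff)
qed


section \<open>Extending an action by one more letter\<close>

text \<open>
  The summand \<open>nat \<times> ('a + 'a)\<close> holds infinitely many copies of \<open>('a, f)\<close> and of \<open>('a, f')\<close>.
  They absorb the complements of the ranges of \<open>k\<close> and \<open>k'\<close>, as in Hilbert's hotel.
\<close>

lemma extend_conjugation:
  fixes f f' :: "'a \<Rightarrow> 'a" and k k' :: "'d \<Rightarrow> 'a"
  assumes f: "bij f" "bij f'" and k: "inj k" "inj k'" and s: "surj s"
    and fk: "\<And>d. f (k d) = k (s d)" "\<And>d. f' (k' d) = k' (s d)"
  defines "\<tau> \<equiv> map_prod id (map_sum f f')"
  obtains \<sigma> :: "'a + nat \<times> ('a + 'a) \<Rightarrow> 'a + nat \<times> ('a + 'a)"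
  where "bij \<sigma>" "\<And>d. \<sigma> (Inl (k d)) = Inl (k' d)"
    "\<And>p. \<sigma> (map_sum f \<tau> p) = map_sum f' \<tau> (\<sigma> p)"
proof -
  have D: "f x \<in> range k \<longleftrightarrow> x \<in> range k" for x
    using f(1) s fk(1) by (metis (no_types, lifting) bij_is_inj injD rangeE rangeI surjE)
  have D': "f' x \<in> range k' \<longleftrightarrow> x \<in> range k'" for x
    using f(2) s fk(2) by (metis (no_types, lifting) bij_is_inj injD rangeE rangeI surjE)
  \<comment> \<open>Outside \<open>range k\<close> a point leaves the main summand for copy 0 of the
    \<open>f\<close>-set, whose copies move up by one; outside \<open>range k'\<close> the copies of
    the \<open>f'\<close>-set move down by one, copy 0 filling the gap in the main summand. Copies
    of points of \<open>range k\<close> and \<open>range k'\<close> stay put.\<close>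
  define \<sigma> :: "'a + nat \<times> ('a + 'a) \<Rightarrow> 'a + nat \<times> ('a + 'a)" where
    "\<sigma> = (\<lambda>p. case p of
       Inl x \<Rightarrow> if x \<in> range k then Inl (k' (inv_into UNIV k x)) else Inr (0, Inl x)
     | Inr (n, Inl x) \<Rightarrow> Inr (if x \<in> range k then n else Suc n, Inl x)
     | Inr (n, Inr y) \<Rightarrow> if y \<in> range k' then Inr (n, Inr y)
         else (case n of 0 \<Rightarrow> Inl y | Suc m \<Rightarrow> Inr (m, Inr y)))"
  have \<sigma>k [simp]: "\<sigma> (Inl (k d)) = Inl (k' d)" for d
    using k by (simp add: \<sigma>_def)
  have \<sigma>_simps [simp]:
    "x \<notin> range k \<Longrightarrow> \<sigma> (Inl x) = Inr (0, Inl x)"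
    "\<sigma> (Inr (n, Inl x)) = Inr (if x \<in> range k then n else Suc n, Inl x)"
    "y \<in> range k' \<Longrightarrow> \<sigma> (Inr (n, Inr y)) = Inr (n, Inr y)"
    "y \<notin> range k' \<Longrightarrow> \<sigma> (Inr (0, Inr y)) = Inl y"
    "y \<notin> range k' \<Longrightarrow> \<sigma> (Inr (Suc n, Inr y)) = Inr (n, Inr y)" for x y n
    by (simp_all add: \<sigma>_def)
  have inj: "inj \<sigma>"
    using k by (auto simp: inj_def \<sigma>_def inv_f_f split: sum.splits if_splits nat.splits) metis
  have surj: "\<exists>q. p = \<sigma> q" for p
  proof (cases p)
    case (Inl y)
    then show ?thesis
      by (cases "y \<in> range k'") (metis \<sigma>k rangeE, metis \<sigma>_simps(4))
  next
    case (Inr q)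
    then obtain n e where p: "p = Inr (n, e)" by (cases q) auto
    show ?thesis
    proof (cases e)
      case (Inl x)
      show ?thesis
      proof (cases "x \<in> range k")
        case True
        then have "p = \<sigma> (Inr (n, Inl x))" by (simp add: p Inl)
        then show ?thesis ..
      next
        case False
        then have "p = \<sigma> (case n of 0 \<Rightarrow> Inl x | Suc m \<Rightarrow> Inr (m, Inl x))"
          by (simp add: p Inl split: nat.split)
        then show ?thesis ..
      qed
    next
      case (Inr y)
      have "p = \<sigma> (Inr (if y \<in> range k' then n else Suc n, Inr y))"
        by (simp add: p Inr)
      then show ?thesis ..
    qed
  qed
  have "\<sigma> (map_sum f \<tau> p) = map_sum f' \<tau> (\<sigma> p)" for p
  proof (cases p)
    case (Inl x)
    show ?thesis
    proof (cases "x \<in> range k")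
      case True
      then show ?thesis using Inl by (auto simp: fk)
    next
      case False
      then show ?thesis using Inl by (simp add: D \<tau>_def)
    qed
  next
    case (Inr q)
    obtain n e where q: "q = (n, e)" by (cases q)
    show ?thesis
    proof (cases e)
      case (Inl x)
      then show ?thesis using Inr q by (simp add: D \<tau>_def)
    next
      case e: (Inr y)
      show ?thesis
        by (cases "y \<in> range k'"; cases n) (simp_all add: Inr q e D' \<tau>_def)
    qed
  qed
  with inj surj show thesis
    by (intro that[of \<sigma>]) (auto simp: bij_def surj_def)
qed

text \<open>An action of \<open>G_i(w)\<close>: in right-action order the clause reads
  \<open>a_j t = t a_j w_j\<close>, which is the relation \<open>t^-1 a_j t = a_j w_j\<close>. The
  remaining letters are arbitrary permutations.\<close>

definition hydra_action :: "(nat \<Rightarrow> letter gword) \<Rightarrow> nat \<Rightarrow> (letter \<Rightarrow> 'a \<Rightarrow> 'a) \<Rightarrow> bool" where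
  "hydra_action w i \<rho> \<longleftrightarrow> (\<forall>x. bij (\<rho> x)) \<and>
    (\<forall>j\<in>{1..i}. \<forall>p. \<rho> T (\<rho> (A j) p) = word_act \<rho> (w j) (\<rho> (A j) (\<rho> T p)))"

lemma bij_map_sum:
  assumes "bij f" "bij g"
  shows "bij (map_sum f g)"
proof (rule o_bij)
  show "map_sum (inv_into UNIV f) (inv_into UNIV g) \<circ> map_sum f g = id"
    using assms by (simp add: map_sum.comp bij_is_inj map_sum.id)
  show "map_sum f g \<circ> map_sum (inv_into UNIV f) (inv_into UNIV g) = id"
    using assms by (simp add: map_sum.comp bij_is_surj surj_iff[THEN iffD1] map_sum.id)
qed

lemma bij_map_prod_id: "bij f \<Longrightarrow> bij (map_prod id f)"
  by (metis bij_betw_map_prod bij_id UNIV_Times_UNIV)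

text \<open>The relation for the new letter \<open>a\<close> says \<open>a^-1 t a = t w^-1\<close>,
  so \<open>a\<close> must intertwine the action \<open>f\<close> of \<open>t\<close> with the
  action \<open>f'\<close> of \<open>t w^-1\<close>. \<open>Tk\<close> and \<open>Tk'\<close> make
  the prescription of \<open>a\<close> on the range of \<open>k\<close> compatible with
  this.\<close>

lemma extend_hydra_action:
  fixes \<rho> :: "letter \<Rightarrow> 'a \<Rightarrow> 'a" and k k' :: "'d \<Rightarrow> 'a"
  assumes act: "hydra_action w i \<rho>"
    and w: "\<And>j. j \<in> {1..Suc i} \<Longrightarrow> w j \<in> gwords (A ` {1..<j})"
    and k: "inj k" "inj k'" and s: "surj s"
    and Tk: "\<And>d. \<rho> T (k d) = k (s d)"
    and Tk': "\<And>d. \<rho> T (k' d) = word_act \<rho> (w (Suc i)) (k' (s d))"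
  obtains \<rho>' :: "letter \<Rightarrow> 'a + nat \<times> ('a + 'a) \<Rightarrow> 'a + nat \<times> ('a + 'a)"
  where "hydra_action w (Suc i) \<rho>'"
    "\<And>x p. x \<noteq> A (Suc i) \<Longrightarrow> \<rho>' x (Inl p) = Inl (\<rho> x p)"
    "\<And>d. \<rho>' (A (Suc i)) (Inl (k d)) = Inl (k' d)"
proof -
  define f where "f = \<rho> T"
  define v where "v = w (Suc i)"
  define f' where "f' = inv_into UNIV (word_act \<rho> v) \<circ> f"
  define \<tau> where "\<tau> = (map_prod id (map_sum f f') :: nat \<times> ('a + 'a) \<Rightarrow> _)"
  have bij: "bij (\<rho> x)" for x using act by (simp add: hydra_action_def)
  have bij_v: "bij (word_act \<rho> v)" by (rule bij_word_act) (rule bij)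
  have bij_f: "bij f" "bij f'"
    using bij bij_v by (simp_all add: f_def f'_def bij_comp bij_imp_bij_inv)
  have f'k': "f' (k' d) = k' (s d)" for d
    using Tk'[of d] bij_v by (simp add: f'_def f_def v_def bij_is_inj inv_f_f)
  obtain \<sigma> where \<sigma>: "bij \<sigma>" "\<And>d. \<sigma> (Inl (k d)) = Inl (k' d)"
    "\<And>p. \<sigma> (map_sum f \<tau> p) = map_sum f' \<tau> (\<sigma> p)"
    by (rule extend_conjugation[of f f' k k' s, OF bij_f k s Tk[folded f_def] f'k', folded \<tau>_def])
      (rule that)
  \<comment> \<open>All letters other than \<open>T\<close> and the new one fix the added copies.
    There the words \<open>w j\<close> are trivial, so \<open>t\<close> and \<open>t w^-1\<close>
    both act as \<open>\<tau>\<close>, even on the copies where \<open>\<tau>\<close> is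
    \<open>f'\<close>.\<close>
  define \<rho>' where "\<rho>' x = (if x = T then map_sum f \<tau> else if x = A (Suc i) then \<sigma>
    else map_sum (\<rho> x) id)" for x
  have bij': "bij (\<rho>' x)" for x
    using bij bij_f \<sigma>(1) by (simp add: \<rho>'_def \<tau>_def bij_map_sum bij_map_prod_id)
  have embed: "\<rho>' x (Inl p) = Inl (\<rho> x p)" if "x \<noteq> A (Suc i)" for x p
    using that by (simp add: \<rho>'_def f_def)
  have old: "word_act \<rho>' (w j) (Inl p) = Inl (word_act \<rho> (w j) p)"
    "word_act \<rho>' (w j) (Inr e) = Inr e" if "j \<in> {1..Suc i}" for j p e
  proof -
    have letters: "x \<in> A ` {1..<Suc i}" if "x \<in> fst ` set (w j)" for x
      using w[OF \<open>j \<in> _\<close>] that \<open>j \<in> _\<close> by (fastforce simp: gwords_def)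
    show "word_act \<rho>' (w j) (Inl p) = Inl (word_act \<rho> (w j) p)"
    proof (rule word_act_embed[of \<rho> \<rho>', OF bij bij'])
      show "\<rho>' x (Inl q) = Inl (\<rho> x q)" if "x \<in> fst ` set (w j)" for x q
        using letters[OF that] by (intro embed) auto
    qed
    have "word_act \<rho>' (w j) (Inr e) = Inr (word_act (\<lambda>_. id) (w j) e)"
    proof (rule word_act_embed[of "\<lambda>_. id" \<rho>', OF _ bij'])
      show "\<rho>' x (Inr q) = Inr (id q)" if "x \<in> fst ` set (w j)" for x q
        using letters[OF that] by (auto simp: \<rho>'_def)
    qed (rule bij_id)
    moreover have "word_act (\<lambda>_. id) u e = e" for u :: "letter gword"
      by (induction u) auto
    ultimately show "word_act \<rho>' (w j) (Inr e) = Inr e" by simp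
  qed
  have "\<rho>' T (\<rho>' (A j) p) = word_act \<rho>' (w j) (\<rho>' (A j) (\<rho>' T p))" if "j \<in> {1..Suc i}" for j p
  proof (cases "j = Suc i")
    case False
    then have j: "j \<in> {1..i}" using that by simp
    show ?thesis
    proof (cases p)
      case (Inl q)
      then show ?thesis
        using act j False by (simp add: hydra_action_def embed old[OF that])
    next
      case (Inr e)
      then show ?thesis using False old(2)[OF that] by (simp add: \<rho>'_def)
    qed
  next
    case True
    have "word_act \<rho>' v (map_sum f' \<tau> q) = map_sum f \<tau> q" for q
    proof (cases q)
      case (Inl q')
      have "word_act \<rho> v (f' q') = f q'"
        using bij_v by (simp add: f'_def bij_is_surj surj_f_inv_f)
      then show ?thesis using Inl old[of "Suc i"] by (simp add: v_def)
    next
      case (Inr e)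
      then show ?thesis using old[of "Suc i"] by (simp add: v_def)
    qed
    then show ?thesis using \<sigma>(3)[of p] True by (simp add: \<rho>'_def v_def)
  qed
  then have "hydra_action w (Suc i) \<rho>'"
    using bij' by (simp add: hydra_action_def)
  then show thesis
    using embed \<sigma>(2) by (intro that[of \<rho>']) (simp_all add: \<rho>'_def)
qed


text \<open>The type of points grows at each stage; conjugation by a bijection returns to a fixed
  type, so that the stages can be iterated by induction.\<close>

lemma transport_hydra_action:
  fixes \<rho> :: "letter \<Rightarrow> 'a \<Rightarrow> 'a" and h :: "'a \<Rightarrow> 'b"
  assumes act: "hydra_action w i \<rho>" and h: "bij h"
  obtains \<rho>' where "hydra_action w i \<rho>'" "\<And>x p. \<rho>' x (h p) = h (\<rho> x p)"
proof -
  define \<rho>' where "\<rho>' x = h \<circ> \<rho> x \<circ> inv_into UNIV h" for x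
  have bij: "bij (\<rho> x)" for x using act by (simp add: hydra_action_def)
  have bij': "bij (\<rho>' x)" for x
    using bij h by (simp only: \<rho>'_def bij_comp bij_imp_bij_inv)
  have \<rho>'h: "\<rho>' x (h p) = h (\<rho> x p)" for x p
    using h by (simp add: \<rho>'_def bij_is_inj inv_f_f)
  have "\<rho>' T (\<rho>' (A j) q) = word_act \<rho>' (w j) (\<rho>' (A j) (\<rho>' T q))" if "j \<in> {1..i}" for j q
  proof -
    obtain p where "q = h p" using h by (meson bij_is_surj surjD)
    then show ?thesis
      using act that word_act_embed[of \<rho> \<rho>' "w j" h, OF bij bij' \<rho>'h]
      by (simp add: \<rho>'h hydra_action_def)
  qed
  then show thesis
    using bij' \<rho>'h by (intro that[of \<rho>']) (simp_all add: hydra_action_def)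
qed


section \<open>Actions with a distinguished orbit\<close>

lemma bij_int_orbit:
  assumes "bij f"
  obtains z :: "int \<Rightarrow> 'a" where "z 0 = p" "\<And>n. f (z n) = z (n + 1)"
proof -
  define z where "z n = (if n \<ge> 0 then (f ^^ nat n) p else (inv_into UNIV f ^^ nat (- n)) p)" for n
  have "f (z n) = z (n + 1)" for n
  proof (cases "n \<ge> 0")
    case True
    then show ?thesis by (simp add: z_def nat_add_distrib)
  next
    case False
    then have "nat (- n) = Suc (nat (- (n + 1)))" by simp
    then have "f (z n) = (inv_into UNIV f ^^ nat (- (n + 1))) p"
      using False assms by (simp add: z_def bij_is_surj surj_f_inv_f)
    also have "\<dots> = z (n + 1)" by (cases "n = - 1") (use False in \<open>simp_all add: z_def\<close>)
    finally show ?thesis .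
  qed
  then show thesis by (intro that[of z]) (simp_all add: z_def)
qed

text \<open>A coincidence at indices \<open>a < b\<close> translates to one at \<open>a - b\<close>
  and 0. So only negative indices have to be tested, where the descent argument applies.\<close>

lemma inj_int_orbit:
  fixes z :: "int \<Rightarrow> 'a"
  assumes f: "inj f" "\<And>n. f (z n) = z (n + 1)" and aper: "\<And>p. z (- int (Suc p)) \<noteq> z 0"
  shows "inj z"
proof -
  have shift: "z (a + k) = z (b + k)" if "z a = z b" for a b k
  proof (induction k rule: int_induct[where k = 0])
    case (step1 k)
    then show ?case using f(2)[of "a + k"] f(2)[of "b + k"] by (simp add: add.assoc)
  next
    case (step2 k)
    have "f (z (a + (k - 1))) = f (z (b + (k - 1)))"
      using step2 f(2)[of "a + (k - 1)"] f(2)[of "b + (k - 1)"] by (simp add: add.assoc)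
    then show ?case using f(1) by (simp add: inj_eq)
  qed (simp add: that)
  have "False" if "z a = z b" "a < b" for a b
    using shift[OF that(1), of "- b"] aper[of "nat (b - a - 1)"] that(2) by simp
  then show ?thesis by (metis injI linorder_cases)
qed

text \<open>The value \<open>z (- int (r j))\<close> makes \<open>a_j t^(r_j)\<close> fix the base
  point \<open>z 0\<close>. The descent clause on the nonpositive half carries the induction: it
  keeps the orbit prescribed for the next letter infinite.\<close>

definition pointed_hydra_action ::
  "(nat \<Rightarrow> letter gword) \<Rightarrow> (nat \<Rightarrow> nat) \<Rightarrow> nat \<Rightarrow> (letter \<Rightarrow> 'a \<Rightarrow> 'a) \<Rightarrow> (int \<Rightarrow> 'a) \<Rightarrow> bool" where
  "pointed_hydra_action w r i \<rho> z \<longleftrightarrow> hydra_action w i \<rho> \<and> inj z \<and>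
    (\<forall>n. \<rho> T (z n) = z (n + 1)) \<and>
    (\<forall>j\<in>{1..i}. \<rho> (A j) (z 0) = z (- int (r j)) \<and> (\<forall>n\<le>0. \<exists>m\<le>n. \<rho> (A j) (z n) = z m))"

lemma word_act_positive_descends:
  fixes z :: "int \<Rightarrow> 'a"
  assumes "\<And>x n. x \<in> X \<Longrightarrow> n \<le> 0 \<Longrightarrow> \<exists>m\<le>n. \<rho> x (z n) = z m"
    and "u \<in> gwords X" "positive_word u" "n \<le> 0"
  shows "\<exists>m\<le>n. word_act \<rho> u (z n) = z m"
  using assms(2-)
proof (induction u arbitrary: n)
  case (Cons q u)
  then obtain x where q: "q = (x, True)" "x \<in> X" by (cases q) (auto simp: positive_word_def)
  obtain m where m: "m \<le> n" "\<rho> x (z n) = z m" using assms(1)[OF q(2) Cons.prems(3)] by blast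
  have "positive_word u" using Cons.prems by (simp add: positive_word_def)
  then show ?case using Cons.IH[of m] Cons.prems m q by (auto intro: order_trans)
qed auto

text \<open>The new letter has to map the orbit \<open>z\<close> to an orbit \<open>z'\<close> of
  \<open>t w^-1\<close> starting at \<open>z (- int (r (Suc i)))\<close>. The obstacle is
  injectivity of \<open>z'\<close>; positivity of the new word removes it.\<close>

lemma extend_pointed_hydra_action:
  fixes \<rho> :: "letter \<Rightarrow> 'a \<Rightarrow> 'a"
  assumes act: "pointed_hydra_action w r i \<rho> z"
    and w: "\<And>j. j \<in> {1..Suc i} \<Longrightarrow> w j \<in> gwords (A ` {1..<j})"
    and pos: "positive_word (w (Suc i))"
  obtains \<rho>' :: "letter \<Rightarrow> 'a + nat \<times> ('a + 'a) \<Rightarrow> 'a + nat \<times> ('a + 'a)"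
  where "pointed_hydra_action w r (Suc i) \<rho>' (Inl \<circ> z)"
    "\<And>x p. x \<noteq> A (Suc i) \<Longrightarrow> \<rho>' x (Inl p) = Inl (\<rho> x p)"
proof -
  define v where "v = w (Suc i)"
  have hyd: "hydra_action w i \<rho>" and z: "inj z" and Tz: "\<rho> T (z n) = z (n + 1)"
    and Az: "j \<in> {1..i} \<Longrightarrow> \<rho> (A j) (z 0) = z (- int (r j))"
      "j \<in> {1..i} \<Longrightarrow> n \<le> 0 \<Longrightarrow> \<exists>m\<le>n. \<rho> (A j) (z n) = z m" for n j
    using act by (simp_all add: pointed_hydra_action_def)
  have bij: "bij (\<rho> x)" for x using hyd by (simp add: hydra_action_def)
  have bij_v: "bij (word_act \<rho> v)" using bij by (rule bij_word_act)
  define f' where "f' = inv_into UNIV (word_act \<rho> v) \<circ> \<rho> T"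
  have bij_f': "bij f'" using bij bij_v by (simp add: f'_def bij_comp bij_imp_bij_inv)
  obtain z' :: "int \<Rightarrow> 'a" where z'0: "z' 0 = z (- int (r (Suc i)))" and f'z': "\<And>n. f' (z' n) = z' (n + 1)"
    by (rule bij_int_orbit[of f' "z (- int (r (Suc i)))", OF bij_f']) (rule that)
  have Tz': "\<rho> T (z' n) = word_act \<rho> v (z' (n + 1))" for n
    using bij_v by (simp add: f'_def bij_is_surj surj_f_inv_f flip: f'z')
  \<comment> \<open>Backwards, \<open>z'\<close> is iterated by \<open>w t^-1\<close>: the positive
    word does not raise the index and \<open>t^-1\<close> lowers it by one. Thus the negative half
    of \<open>z'\<close> stays in the orbit \<open>z\<close> and never returns to its start.\<close>
  have desc: "\<exists>m \<le> - int (r (Suc i)) - int p. z' (- int p) = z m" for p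
  proof (induction p)
    case 0
    then show ?case using z'0 by auto
  next
    case (Suc p)
    then obtain m where m: "m \<le> - int (r (Suc i)) - int p" "z' (- int p) = z m" by blast
    have "\<exists>l\<le>m. word_act \<rho> v (z m) = z l"
    proof (rule word_act_positive_descends)
      show "v \<in> gwords (A ` {1..i})" "positive_word v"
        using w[of "Suc i"] pos by (simp_all add: v_def atLeastLessThanSuc_atLeastAtMost)
    qed (use Az m(1) in auto)
    then obtain l where l: "l \<le> m" "word_act \<rho> v (z m) = z l" by blast
    have "\<rho> T (z' (- int (Suc p))) = \<rho> T (z (l - 1))"
      using Tz'[of "- int (Suc p)"] Tz[of "l - 1"] m(2) l(2) by simp
    then have "z' (- int (Suc p)) = z (l - 1)"
      using bij by (metis bij_is_inj injD)
    then show ?case using l m by (intro exI[of _ "l - 1"]) simp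
  qed
  have inj_z': "inj z'"
  proof (rule inj_int_orbit[of f' z', OF bij_is_inj[OF bij_f'] f'z'])
    fix p
    obtain m where m: "m \<le> - int (r (Suc i)) - int (Suc p)" "z' (- int (Suc p)) = z m"
      using desc[of "Suc p"] by blast
    then have "m \<noteq> - int (r (Suc i))" by linarith
    then show "z' (- int (Suc p)) \<noteq> z' 0"
      using m(2) z'0 z by (simp add: inj_eq)
  qed
  have surj: "surj (\<lambda>n :: int. n + 1)" by (rule surjI[of _ "\<lambda>n. n - 1"]) simp
  obtain \<rho>' :: "letter \<Rightarrow> 'a + nat \<times> ('a + 'a) \<Rightarrow> _"
    where hyd': "hydra_action w (Suc i) \<rho>'"
    and embed: "\<And>x p. x \<noteq> A (Suc i) \<Longrightarrow> \<rho>' x (Inl p) = Inl (\<rho> x p)"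
    and \<rho>'z: "\<And>n. \<rho>' (A (Suc i)) (Inl (z n)) = Inl (z' n)"
    by (rule extend_hydra_action[of w i \<rho> z z' "\<lambda>n. n + 1", OF hyd w z inj_z' surj Tz Tz'[unfolded v_def]])
      (assumption, rule that)
  have "\<rho>' (A j) (Inl (z 0)) = Inl (z (- int (r j))) \<and>
      (\<forall>n\<le>0. \<exists>m\<le>n. \<rho>' (A j) (Inl (z n)) = Inl (z m))" if "j \<in> {1..Suc i}" for j
  proof (cases "j = Suc i")
    case True
    have "\<exists>m\<le>n. z' n = z m" if "n \<le> 0" for n
    proof -
      obtain m where "m \<le> - int (r (Suc i)) - int (nat (- n))" "z' (- int (nat (- n))) = z m"
        using desc[of "nat (- n)"] by blast
      then show ?thesis using that by (intro exI[of _ m]) simp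
    qed
    then show ?thesis using True by (simp add: \<rho>'z z'0)
  next
    case False
    then show ?thesis using that Az by (simp add: embed)
  qed
  then have "pointed_hydra_action w r (Suc i) \<rho>' (Inl \<circ> z)"
    using hyd' z Tz by (simp add: pointed_hydra_action_def embed inj_def)
  then show thesis using embed by (rule that)
qed

section \<open>Iterating the extension up to the last letter\<close>

lemma transport_pointed_hydra_action:
  fixes \<rho> :: "letter \<Rightarrow> 'a \<Rightarrow> 'a" and h :: "'a \<Rightarrow> 'b"
  assumes act: "pointed_hydra_action w r i \<rho> z" and h: "bij h"
  obtains \<rho>' where "pointed_hydra_action w r i \<rho>' (h \<circ> z)" "\<And>x p. \<rho>' x (h p) = h (\<rho> x p)"
proof -
  obtain \<rho>' where \<rho>': "hydra_action w i \<rho>'" "\<And>x p. \<rho>' x (h p) = h (\<rho> x p)"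
    by (rule transport_hydra_action[of w i \<rho> h]) (use act h that in \<open>auto simp: pointed_hydra_action_def\<close>)
  moreover have "inj (h \<circ> z)"
    using act h by (auto simp: pointed_hydra_action_def bij_is_inj intro: inj_compose)
  moreover have "\<exists>m\<le>n. \<rho>' (A j) (h (z n)) = h (z m)" if "j \<in> {1..i}" "n \<le> 0" for j n
    using act that unfolding pointed_hydra_action_def \<rho>'(2) by metis
  ultimately have "pointed_hydra_action w r i \<rho>' (h \<circ> z)"
    using act by (simp add: pointed_hydra_action_def)
  then show thesis using \<rho>'(2) by (rule that)
qed

lemma ex_bij_nat: "\<exists>h :: 'a \<Rightarrow> nat. bij h" if "infinite (UNIV :: 'a :: countable set)"
  by (rule exI[of _ "to_nat_on UNIV"]) (rule to_nat_on_infinite[OF countableI_type that])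

text \<open>Each extension keeps the old letters unchanged on the embedded points, and the letters
  added after stage \<open>c\<close> do not occur in \<open>g\<close>. So \<open>g\<close> still
  moves the embedded base point.\<close>

lemma pointed_hydra_action_later_stage:
  assumes "pointed_hydra_action w r c \<rho> (z :: int \<Rightarrow> nat)" and "word_act \<rho> g (z 0) \<noteq> z 0"
    and "fst ` set g \<subseteq> insert T (A ` {1..c})" and "c \<le> k"
    and w: "\<And>j. j \<in> {1..k} \<Longrightarrow> w j \<in> gwords (A ` {1..<j}) \<and> positive_word (w j)"
  shows "\<exists>\<rho> (z :: int \<Rightarrow> nat). pointed_hydra_action w r k \<rho> z \<and> word_act \<rho> g (z 0) \<noteq> z 0"
  using \<open>c \<le> k\<close> w
proof (induction k rule: dec_induct)
  case base
  then show ?case using assms by blast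
next
  case (step i)
  have "\<exists>\<rho> (z :: int \<Rightarrow> nat). pointed_hydra_action w r i \<rho> z \<and> word_act \<rho> g (z 0) \<noteq> z 0"
    using step by auto
  then obtain \<rho> and z :: "int \<Rightarrow> nat"
    where \<rho>: "pointed_hydra_action w r i \<rho> z" and g: "word_act \<rho> g (z 0) \<noteq> z 0" by blast
  obtain \<rho>1 :: "letter \<Rightarrow> nat + nat \<times> (nat + nat) \<Rightarrow> _"
    where \<rho>1: "pointed_hydra_action w r (Suc i) \<rho>1 (Inl \<circ> z)"
      and embed1: "\<And>x p. x \<noteq> A (Suc i) \<Longrightarrow> \<rho>1 x (Inl p) = Inl (\<rho> x p)"
    by (rule extend_pointed_hydra_action[OF \<rho>]) (use step.prems that in auto)
  obtain h :: "nat + nat \<times> (nat + nat) \<Rightarrow> nat" where h: "bij h"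
    using ex_bij_nat[where 'a = "nat + nat \<times> (nat + nat)"] by (auto simp: finite_Plus_UNIV_iff)
  obtain \<rho>2 where \<rho>2: "pointed_hydra_action w r (Suc i) \<rho>2 (h \<circ> (Inl \<circ> z))"
    and embed2: "\<And>x p. \<rho>2 x (h p) = h (\<rho>1 x p)"
    by (rule transport_pointed_hydra_action[OF \<rho>1 h]) (rule that)
  have "word_act \<rho>2 g (h (Inl p)) = h (Inl (word_act \<rho> g p))" for p
  proof -
    have "x \<noteq> A (Suc i)" if "x \<in> fst ` set g" for x
      using that assms(3) step.hyps by auto
    then have "\<rho>2 x ((h \<circ> Inl) p) = (h \<circ> Inl) (\<rho> x p)" if "x \<in> fst ` set g" for x p
      using that embed1 embed2 by simp
    then show ?thesis
      using word_act_embed[of \<rho> \<rho>2 g "h \<circ> Inl" p] \<rho> \<rho>2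
      by (simp add: pointed_hydra_action_def hydra_action_def)
  qed
  then have "word_act \<rho>2 g ((h \<circ> (Inl \<circ> z)) 0) \<noteq> (h \<circ> (Inl \<circ> z)) 0"
    using g h by (simp add: bij_is_inj inj_eq)
  then show ?case using \<rho>2 by blast
qed


section \<open>The first nontrivial stage\<close>

text \<open>The number \<open>s\<close>, as a natural number so that it can be an exponent of
  \<open>t\<close>. Signs are ignored; for positive words in the \<open>a_j\<close> it is the
  weighted sum of index sums (\<open>T_weight_index_sum\<close>).\<close>

definition T_weight :: "(nat \<Rightarrow> nat) \<Rightarrow> letter gword \<Rightarrow> nat" where
  "T_weight r u = (\<Sum>(x, e) \<leftarrow> u. case x of A j \<Rightarrow> r j | T \<Rightarrow> 0)"

text \<open>Meant for positive words in the \<open>a_j\<close>, where it is evaluation at the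
  generators of \<open>H\<close>; \<open>W\<close> is represented by
  \<open>shifted_word r (w c)\<close>.\<close>

definition shifted_word :: "(nat \<Rightarrow> nat) \<Rightarrow> letter gword \<Rightarrow> letter gword" where
  "shifted_word r u = concat (map (\<lambda>(x, e). case x of
     A j \<Rightarrow> (A j, True) # replicate (r j) (T, True) | T \<Rightarrow> []) u)"

lemma positive_gword_induct [consumes 2, case_names Nil Cons]:
  assumes "u \<in> gwords (A ` I)" "positive_word u" "P []"
    and "\<And>j u. j \<in> I \<Longrightarrow> u \<in> gwords (A ` I) \<Longrightarrow> positive_word u \<Longrightarrow> P u \<Longrightarrow> P ((A j, True) # u)"
  shows "P u"
  using assms(1,2)
proof (induction u)
  case (Cons q u)
  then show ?case using assms(4) by (cases q) (auto simp: positive_word_def)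
qed (rule assms(3))

lemma T_weight_index_sum:
  assumes "u \<in> gwords (A ` I)" "positive_word u" "finite I"
  shows "int (T_weight r u) = (\<Sum>i\<in>I. index_sum (A i) u * int (r i))"
  using assms(1,2)
proof (induction rule: positive_gword_induct)
  case Nil
  then show ?case by (simp add: T_weight_def index_sum_def)
next
  case (Cons j u)
  have "index_sum (A i) ((A j, True) # u) * int (r i)
      = (if i = j then int (r i) else 0) + index_sum (A i) u * int (r i)" for i
    by (simp add: index_sum_def algebra_simps)
  then show ?case
    using Cons assms(3) by (simp add: T_weight_def sum.distrib)
qed

lemma word_act_replicate_T:
  fixes y :: "int \<Rightarrow> 'a"
  assumes "\<And>n. \<rho> x (y n) = y (n + 1)"
  shows "word_act \<rho> (replicate m (x, True)) (y n) = y (n + int m)"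
  by (induction m arbitrary: n) (simp_all add: assms add.assoc)

section \<open>The element \<open>g\<close> as a word\<close>

definition witness_word :: "(nat \<Rightarrow> letter gword) \<Rightarrow> (nat \<Rightarrow> nat) \<Rightarrow> nat \<Rightarrow> letter gword" where
  "witness_word w r c = (let b = (A c, True) # replicate (r c) (T, True) in
     [(T, True)] @ word_inv b @ shifted_word r (w c) @ b @ [(T, False)])"

lemma replicate_gwords: "fst p \<in> X \<Longrightarrow> replicate n p \<in> gwords X"
  by (auto simp: gwords_def)

lemma shifted_word_gwords:
  assumes "u \<in> gwords (A ` I)" "positive_word u"
  shows "shifted_word r u \<in> gwords (insert T (A ` I))"
  using assms
  by (induction rule: positive_gword_induct) (simp_all add: shifted_word_def replicate_gwords)

lemma witness_word_gwords:
  assumes "w c \<in> gwords (A ` {1..<c})" "positive_word (w c)" "c \<ge> 1"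
  shows "witness_word w r c \<in> gwords (insert T (A ` {1..c}))"
proof -
  have "shifted_word r (w c) \<in> gwords (insert T (A ` {1..c}))"
    using shifted_word_gwords[OF assms(1,2), of r] by (force simp: gwords_def)
  then show ?thesis using assms(3) by (auto simp: witness_word_def Let_def replicate_gwords)
qed

text \<open>
  In the orbit \<open>Inl\<close> of the base point every \<open>a\<^sub>j\<close> with \<open>j < c\<close> acts as \<open>t\<close> to the power
  \<open>- r j\<close>; in the second orbit it acts trivially, and \<open>a\<^sub>c\<close> maps the two orbits
  affinely onto disjoint parts of the first one.
\<close>

lemma pointed_hydra_action_first_stage:
  assumes c: "c \<ge> 1"
    and w: "\<And>j. j \<in> {1..c} \<Longrightarrow> w j \<in> gwords (A ` {1..<j}) \<and> positive_word (w j)"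
    and triv: "\<And>j. j \<in> {1..<c} \<Longrightarrow> w j = []"
    and wt: "T_weight r (w c) \<noteq> 0"
  obtains \<rho> and z :: "int \<Rightarrow> nat"
  where "pointed_hydra_action w r c \<rho> z" "word_act \<rho> (witness_word w r c) (z 0) \<noteq> z 0"
proof -
  define s where "s = int (T_weight r (w c))"
  have s: "s > 0" using wt by (simp add: s_def)
  define \<rho>0 :: "letter \<Rightarrow> int + int \<Rightarrow> int + int" where
    "\<rho>0 x = (case x of T \<Rightarrow> map_sum (\<lambda>n. n + 1) (\<lambda>n. n + 1)
      | A j \<Rightarrow> if j < c then map_sum (\<lambda>n. n - int (r j)) id else id)" for x
  obtain i where i: "c = Suc i" using c by (cases c) auto
  have bij_shift: "bij (\<lambda>n. n + a)" "bij (\<lambda>n. n - a)" for a :: int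
    by (rule o_bij[of "\<lambda>n. n - a"]; auto)(rule o_bij[of "\<lambda>n. n + a"]; auto)
  have bij0: "bij (\<rho>0 x)" for x
    by (auto simp: \<rho>0_def bij_shift intro!: bij_map_sum split: letter.split)
  have "\<rho>0 T (\<rho>0 (A j) p) = word_act \<rho>0 (w j) (\<rho>0 (A j) (\<rho>0 T p))" if "j \<in> {1..i}" for j p
    using that triv[of j] by (cases p) (simp_all add: \<rho>0_def i)
  then have hyd0: "hydra_action w i \<rho>0" using bij0 by (simp add: hydra_action_def)
  have "word_act \<rho>0 u (Inl n) = Inl (n - int (T_weight r u))"
    if "u \<in> gwords (A ` {1..<c})" "positive_word u" for u n
    using that by (induction arbitrary: n rule: positive_gword_induct)
      (simp_all add: T_weight_def \<rho>0_def algebra_simps)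
  then have wc: "word_act \<rho>0 (w c) (Inl n) = Inl (n - s)" for n
    using w[of c] c by (simp add: s_def)
  have T0: "\<rho>0 T (Inl n) = Inl (n + 1)" "\<rho>0 T (Inr n) = Inr (n + 1)" for n
    by (simp_all add: \<rho>0_def)
  \<comment> \<open>The action prescribed for \<open>a_c\<close>. As \<open>w_c\<close> shifts the
    first orbit by \<open>- s\<close>, the relation forces slope \<open>1 + s\<close>; the constant
    \<open>- r c\<close> gives the required value at the base point. The extra 1 puts the image of
    the second orbit in another residue class modulo \<open>1 + s\<close> and makes \<open>b\<close>
    send the origin of that orbit to index 1 of the first.\<close>
  define k' :: "int + int \<Rightarrow> int + int" where
    "k' = case_sum (\<lambda>n. Inl ((1 + s) * n - int (r c))) (\<lambda>n. Inl (1 + (1 + s) * n - int (r c)))"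
  have "(1 + s) * m \<noteq> 1 + (1 + s) * n" for m n
  proof
    assume "(1 + s) * m = 1 + (1 + s) * n"
    then have "(1 + s) * (m - n) = 1" by (simp add: algebra_simps)
    then show False using s by (auto simp: zmult_eq_1_iff)
  qed
  note ne = this this[symmetric]
  have inj_k': "inj k'"
    using s by (auto simp: inj_def k'_def ne split: sum.splits)
  have surj: "surj (\<rho>0 T)" using bij0 by (rule bij_is_surj)
  have Tk': "\<rho>0 T (k' d) = word_act \<rho>0 (w c) (k' (\<rho>0 T d))" for d
    by (cases d) (simp_all add: T0 k'_def wc algebra_simps)
  obtain \<rho>1 :: "letter \<Rightarrow> (int + int) + nat \<times> ((int + int) + (int + int)) \<Rightarrow> _"
    where hyd1: "hydra_action w c \<rho>1"
      and embed1: "\<And>x p. x \<noteq> A c \<Longrightarrow> \<rho>1 x (Inl p) = Inl (\<rho>0 x p)"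
      and \<rho>1c: "\<And>d. \<rho>1 (A c) (Inl d) = Inl (k' d)"
  proof (rule extend_hydra_action[of w i \<rho>0 id k' "\<rho>0 T", OF hyd0 _ inj_on_id inj_k' surj])
    show "w j \<in> gwords (A ` {1..<j})" if "j \<in> {1..Suc i}" for j
      using w that by (simp add: i)
    show "\<rho>0 T (k' d) = word_act \<rho>0 (w (Suc i)) (k' (\<rho>0 T d))" for d
      using Tk' by (simp add: i)
  qed (use that in \<open>simp_all add: i\<close>)
  have bij1: "bij (\<rho>1 x)" for x using hyd1 by (simp add: hydra_action_def)
  define y where "y n = (Inl (Inr n) :: (int + int) + nat \<times> ((int + int) + (int + int)))" for n :: int
  define z where "z n = (Inl (Inl n) :: (int + int) + nat \<times> ((int + int) + (int + int)))" for n :: int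
  have T: "\<rho>1 T (y n) = y (n + 1)" "\<rho>1 T (z n) = z (n + 1)" for n
    by (simp_all add: y_def z_def embed1 \<rho>0_def)
  have A_lt: "\<rho>1 (A j) (y n) = y n" "\<rho>1 (A j) (z n) = z (n - int (r j))" if "j < c" for j n
    using that by (simp_all add: y_def z_def embed1 \<rho>0_def)
  have A_c: "\<rho>1 (A c) (y n) = z (1 + (1 + s) * n - int (r c))"
    "\<rho>1 (A c) (z n) = z ((1 + s) * n - int (r c))" for n
    by (simp_all add: y_def z_def \<rho>1c k'_def)
  have "\<exists>m\<le>n. \<rho>1 (A j) (z n) = z m" if "j \<in> {1..c}" "n \<le> 0" for j n
  proof (cases "j = c")
    case True
    have "(1 + s) * n \<le> n" using s that(2) using mult_nonneg_nonpos[of s n] by (simp add: algebra_simps)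
    then show ?thesis using True A_c by (intro exI[of _ "(1 + s) * n - int (r c)"]) simp
  next
    case False
    then show ?thesis using that A_lt by (intro exI[of _ "n - int (r j)"]) simp
  qed
  moreover have "\<rho>1 (A j) (z 0) = z (- int (r j))" if "j \<in> {1..c}" for j
    using that A_c(2)[of 0] A_lt(2)[of j 0] by (cases "j = c") simp_all
  ultimately have ptd1: "pointed_hydra_action w r c \<rho>1 z"
    using hyd1 T by (simp add: pointed_hydra_action_def inj_def z_def)
  \<comment> \<open>The purpose of the second orbit: \<open>a_j t^(r_j)\<close> acts there as
    \<open>t^(r_j)\<close>, so \<open>W\<close> shifts it by \<open>s\<close>, whereas
    \<open>W\<close> fixes the first orbit pointwise.\<close>
  have "word_act \<rho>1 (shifted_word r u) (y n) = y (n + int (T_weight r u))"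
    if "u \<in> gwords (A ` {1..<c})" "positive_word u" for u n
    using that
    by (induction arbitrary: n rule: positive_gword_induct)
      (simp_all add: T_weight_def shifted_word_def A_lt word_act_replicate_T[of \<rho>1 T y, OF T(1)] add.assoc)
  then have W: "word_act \<rho>1 (shifted_word r (w c)) (y n) = y (n + s)" for n
    using w[of c] c by (simp add: s_def)
  define b where "b = (A c, True) # replicate (r c) (T, True)"
  have b: "word_act \<rho>1 b (y n) = z (1 + (1 + s) * n)" for n
    by (simp add: b_def A_c word_act_replicate_T[of \<rho>1 T z, OF T(2)])
  have "word_act \<rho>1 (word_inv b) (z 1) = y 0"
    using word_act_word_inv[of \<rho>1 b "y 0", OF bij1] b[of 0] by simp
  moreover have "inv_into UNIV (\<rho>1 T) (z (n + 1)) = z n" for n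
    using bij1 T(2) by (metis bij_is_inj inv_f_f)
  then have "inv_into UNIV (\<rho>1 T) (z (1 + (1 + s) * s)) = z ((1 + s) * s)"
    by (metis add.commute)
  \<comment> \<open>The path is \<open>z 0\<close>, \<open>z 1\<close>, \<open>y 0\<close>,
    \<open>y s\<close>, \<open>z (1 + (1 + s) * s)\<close>, \<open>z ((1 + s) * s)\<close>, by
    \<open>t\<close>, \<open>b^-1\<close>, \<open>W\<close>, \<open>b\<close>, \<open>t^-1\<close>
    in turn.\<close>
  ultimately have "word_act \<rho>1 (witness_word w r c) (z 0) = z ((1 + s) * s)"
    using T(2)[of 0] by (simp add: witness_word_def W b flip: b_def)
  then have g: "word_act \<rho>1 (witness_word w r c) (z 0) \<noteq> z 0"
    using s by (simp add: z_def)
  obtain h :: "(int + int) + nat \<times> ((int + int) + (int + int)) \<Rightarrow> nat" where h: "bij h"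
    using ex_bij_nat[where 'a = "(int + int) + nat \<times> ((int + int) + (int + int))"]
    by (auto simp: finite_Plus_UNIV_iff infinite_UNIV_int)
  obtain \<rho>2 where \<rho>2: "pointed_hydra_action w r c \<rho>2 (h \<circ> z)"
    and embed2: "\<And>x p. \<rho>2 x (h p) = h (\<rho>1 x p)"
    by (rule transport_pointed_hydra_action[OF ptd1 h]) (rule that)
  have "word_act \<rho>2 u (h p) = h (word_act \<rho>1 u p)" for u p
    using word_act_embed[of \<rho>1 \<rho>2 u h p] bij1 \<rho>2 embed2
    by (simp add: pointed_hydra_action_def hydra_action_def)
  then have "word_act \<rho>2 (witness_word w r c) ((h \<circ> z) 0) \<noteq> (h \<circ> z) 0"
    using g h by (simp add: bij_is_inj inj_eq)
  with \<rho>2 show thesis by (rule that)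
qed


section \<open>Non-separability\<close>

text \<open>The two relations required by \<open>conj_mem_of_finite\<close> are established in the
  group itself and then mapped by \<open>\<phi>\<close>.\<close>

lemma witness_word_image_mem:
  fixes Q :: "('q, 'm) monoid_scheme"
  assumes c: "c \<in> {1..k}"
    and wc: "w c \<in> gwords (A ` {1..<c})" "positive_word (w c)"
    and triv: "\<And>j. j \<in> {1..<c} \<Longrightarrow> w j = []"
    and Q: "group Q" "finite (carrier Q)" and \<phi>: "\<phi> \<in> hom (Gk k w) Q"
  shows "\<phi> (pres_class (Gk_gens k) (Gk_rels k w) (witness_word w r c)) \<in> \<phi> ` Hk k w r"
proof -
  define G where "G = Gk k w"
  define cl where "cl = pres_class (Gk_gens k) (Gk_rels k w)"
  define H where "H = Hk k w r"
  define a where "a j = cl [(A j, True)]" for j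
  define t where "t = cl [(T, True)]"
  define gens where "gens = (\<lambda>j. cl ((A j, True) # replicate (r j) (T, True))) ` {1..k}"
  interpret group_hom G Q \<phi>
    unfolding group_hom_def group_hom_axioms_def
    using Q(1) \<phi> group_presented_group by (simp add: G_def Gk_def)
  have letters: "T \<in> Gk_gens k" "j \<in> {1..k} \<Longrightarrow> A j \<in> Gk_gens k" for j
    by (auto simp: Gk_gens_def)
  have cl_mult: "cl u \<otimes>\<^bsub>G\<^esub> cl v = cl (u @ v)" if "u \<in> gwords (Gk_gens k)" "v \<in> gwords (Gk_gens k)" for u v
    using that by (simp add: cl_def G_def Gk_def pres_mult_class)
  have cl_car: "cl u \<in> carrier G" if "u \<in> gwords (Gk_gens k)" for u
    using that by (simp add: cl_def G_def Gk_def pres_class_in_carrier)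
  have cl_inv: "inv\<^bsub>G\<^esub> cl u = cl (word_inv u)" if "u \<in> gwords (Gk_gens k)" for u
    using that by (simp add: cl_def G_def Gk_def pres_inv_class)
  have cl_Nil: "cl [] = \<one>\<^bsub>G\<^esub>" by (simp add: cl_def G_def Gk_def one_presented_group)
  have a_car [simp]: "a j \<in> carrier G" if "j \<in> {1..k}" for j
    using that letters by (simp add: a_def cl_car)
  have t_car [simp]: "t \<in> carrier G" using letters by (simp add: t_def cl_car)
  have cl_Cons: "cl ((A j, True) # u) = a j \<otimes>\<^bsub>G\<^esub> cl u" if "j \<in> {1..k}" "u \<in> gwords (Gk_gens k)" for j u
    using that letters by (simp add: a_def cl_mult)
  have cl_T: "cl (replicate n (T, True)) = t [^]\<^bsub>G\<^esub> n" for n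
  proof (induction n)
    case (Suc n)
    have "cl (replicate (Suc n) (T, True)) = t \<otimes>\<^bsub>G\<^esub> cl (replicate n (T, True))"
      using letters by (simp add: t_def cl_mult replicate_gwords)
    then show ?case by (simp only: Suc G.nat_pow_Suc2[OF t_car])
  qed (simp add: cl_Nil)
  have H: "subgroup H G" "gens \<subseteq> H"
  proof -
    have "gens \<subseteq> carrier G" using letters by (auto simp: gens_def cl_car replicate_gwords)
    then have "subgroup (generate G gens) G" by (rule G.generate_is_subgroup)
    moreover have "H = generate G gens" by (simp add: H_def Hk_def G_def gens_def cl_def)
    ultimately show "subgroup H G" "gens \<subseteq> H" by (auto intro: generate.incl)
  qed
  interpret HG: subgroup H G by (rule H(1))
  have gen_mem: "a j \<otimes>\<^bsub>G\<^esub> t [^]\<^bsub>G\<^esub> r j \<in> H" if "j \<in> {1..k}" for j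
  proof -
    have "a j \<otimes>\<^bsub>G\<^esub> t [^]\<^bsub>G\<^esub> r j = cl ((A j, True) # replicate (r j) (T, True))"
      using that letters by (simp add: cl_Cons cl_T replicate_gwords)
    then show ?thesis using that H(2) by (auto simp: gens_def)
  qed
  have rel: "a j \<otimes>\<^bsub>G\<^esub> t = t \<otimes>\<^bsub>G\<^esub> a j \<otimes>\<^bsub>G\<^esub> cl (w j)"
    if j: "j \<in> {1..k}" and wj: "w j \<in> gwords (Gk_gens k)" for j
  proof -
    have "pres_eq (Gk_gens k) (Gk_rels k w) (word_conj [(A j, True)] [(T, True)]) ((A j, True) # w j)"
      using j wj letters by (intro pres_eq.rel) (auto simp: Gk_rels_def word_conj_def)
    then have "cl (word_inv [(T, True)] @ [(A j, True)] @ [(T, True)]) = cl ((A j, True) # w j)"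
      using j wj letters by (simp add: cl_def pres_class_eq_iff word_conj_def)
    moreover have "cl (word_inv [(T, True)] @ [(A j, True)] @ [(T, True)])
        = inv\<^bsub>G\<^esub> t \<otimes>\<^bsub>G\<^esub> (a j \<otimes>\<^bsub>G\<^esub> t)"
      using j letters by (simp add: a_def t_def cl_inv cl_mult)
    ultimately have "inv\<^bsub>G\<^esub> t \<otimes>\<^bsub>G\<^esub> (a j \<otimes>\<^bsub>G\<^esub> t) = a j \<otimes>\<^bsub>G\<^esub> cl (w j)"
      using j wj by (simp add: cl_Cons)
    then have "a j \<otimes>\<^bsub>G\<^esub> t = t \<otimes>\<^bsub>G\<^esub> (a j \<otimes>\<^bsub>G\<^esub> cl (w j))"
      using j wj by (metis G.inv_solve_left G.inv_closed G.inv_inv G.m_closed a_car t_car cl_car)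
    then show ?thesis using j wj by (simp add: G.m_assoc cl_car)
  qed
  have sub: "gwords (A ` {1..<c}) \<subseteq> gwords (Gk_gens k)"
    using c by (auto simp: gwords_def Gk_gens_def)
  have at: "t [^]\<^bsub>G\<^esub> (n::nat) \<otimes>\<^bsub>G\<^esub> a j = a j \<otimes>\<^bsub>G\<^esub> t [^]\<^bsub>G\<^esub> n" if "j \<in> {1..<c}" for j n
  proof -
    have j: "j \<in> {1..k}" using that c by simp
    have "a j \<otimes>\<^bsub>G\<^esub> t = t \<otimes>\<^bsub>G\<^esub> a j"
      using rel[OF j] triv[OF that] j by (simp add: cl_Nil)
    then show ?thesis using G.group_commutes_pow[of t "a j" n] j by simp
  qed
  have lcomm: "t [^]\<^bsub>G\<^esub> n \<otimes>\<^bsub>G\<^esub> (y \<otimes>\<^bsub>G\<^esub> x) = y \<otimes>\<^bsub>G\<^esub> (t [^]\<^bsub>G\<^esub> n \<otimes>\<^bsub>G\<^esub> x)"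
    if "t [^]\<^bsub>G\<^esub> n \<otimes>\<^bsub>G\<^esub> y = y \<otimes>\<^bsub>G\<^esub> t [^]\<^bsub>G\<^esub> n" "y \<in> carrier G" "x \<in> carrier G" for n :: nat and x y
    using that by (simp flip: G.m_assoc)
  \<comment> \<open>As \<open>t\<close> commutes with the letters below \<open>c\<close>, its powers
    can be collected on the right; the induction needs the commutation with the remaining word along
    with the formula.\<close>
  have shifted: "shifted_word r u \<in> gwords (Gk_gens k) \<and>
      cl (shifted_word r u) = cl u \<otimes>\<^bsub>G\<^esub> t [^]\<^bsub>G\<^esub> T_weight r u \<and> cl (shifted_word r u) \<in> H \<and>
      (\<forall>n::nat. t [^]\<^bsub>G\<^esub> n \<otimes>\<^bsub>G\<^esub> cl u = cl u \<otimes>\<^bsub>G\<^esub> t [^]\<^bsub>G\<^esub> n)"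
    if "u \<in> gwords (A ` {1..<c})" "positive_word u" for u
    using that
  proof (induction rule: positive_gword_induct)
    case Nil
    then show ?case by (simp add: shifted_word_def T_weight_def cl_Nil)
  next
    case (Cons j u)
    have j: "j \<in> {1..k}" using Cons.hyps(1) c by simp
    have u: "u \<in> gwords (Gk_gens k)" using Cons.hyps sub by blast
    note car = a_car[OF j] cl_car[OF u]
    have eq: "shifted_word r ((A j, True) # u) = ((A j, True) # replicate (r j) (T, True)) @ shifted_word r u"
      by (simp add: shifted_word_def)
    have words: "(A j, True) # replicate (r j) (T, True) \<in> gwords (Gk_gens k)"
      using letters j by (simp add: replicate_gwords)
    have cl_eq: "cl (shifted_word r ((A j, True) # u))
        = (a j \<otimes>\<^bsub>G\<^esub> t [^]\<^bsub>G\<^esub> r j) \<otimes>\<^bsub>G\<^esub> cl (shifted_word r u)"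
      using words Cons.IH letters j unfolding eq
      by (simp only: cl_mult[symmetric] cl_Cons cl_T replicate_gwords fst_conv)
    have "cl (shifted_word r ((A j, True) # u)) \<in> H"
      unfolding cl_eq using HG.m_closed[OF gen_mem[OF j]] Cons.IH by blast
    moreover have comm: "t [^]\<^bsub>G\<^esub> n \<otimes>\<^bsub>G\<^esub> cl u = cl u \<otimes>\<^bsub>G\<^esub> t [^]\<^bsub>G\<^esub> n" for n :: nat
      using Cons.IH by blast
    have "cl (shifted_word r ((A j, True) # u))
        = cl ((A j, True) # u) \<otimes>\<^bsub>G\<^esub> t [^]\<^bsub>G\<^esub> T_weight r ((A j, True) # u)"
      using cl_eq Cons.IH car j u
      by (simp add: T_weight_def G.m_assoc lcomm comm cl_Cons flip: G.nat_pow_mult)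
    moreover have "t [^]\<^bsub>G\<^esub> n \<otimes>\<^bsub>G\<^esub> cl ((A j, True) # u) = cl ((A j, True) # u) \<otimes>\<^bsub>G\<^esub> t [^]\<^bsub>G\<^esub> n" for n :: nat
      using car Cons.hyps(1) j u by (simp add: lcomm at comm cl_Cons G.m_assoc)
    moreover have "shifted_word r ((A j, True) # u) \<in> gwords (Gk_gens k)"
      using words Cons.IH by (simp only: eq gwords_simps)
    ultimately show ?case by blast
  qed
  define s where "s = T_weight r (w c)"
  define W where "W = cl (shifted_word r (w c))"
  define b where "b = a c \<otimes>\<^bsub>G\<^esub> t [^]\<^bsub>G\<^esub> r c"
  have w_car: "w c \<in> gwords (Gk_gens k)" using wc sub by blast
  note [simp] = cl_car[OF w_car] a_car[OF c]
  have W: "W \<in> H" "W = cl (w c) \<otimes>\<^bsub>G\<^esub> t [^]\<^bsub>G\<^esub> s"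
    and tw: "t [^]\<^bsub>G\<^esub> n \<otimes>\<^bsub>G\<^esub> cl (w c) = cl (w c) \<otimes>\<^bsub>G\<^esub> t [^]\<^bsub>G\<^esub> n" for n :: nat
    using shifted[OF wc] by (auto simp: W_def s_def)
  have b: "b \<in> H" using gen_mem[OF c] by (simp add: b_def)
  have "t \<otimes>\<^bsub>G\<^esub> W = cl (w c) \<otimes>\<^bsub>G\<^esub> (t \<otimes>\<^bsub>G\<^esub> t [^]\<^bsub>G\<^esub> s)"
    using lcomm[of 1 "cl (w c)" "t [^]\<^bsub>G\<^esub> s"] tw[of 1] by (simp add: W(2))
  also have "t \<otimes>\<^bsub>G\<^esub> t [^]\<^bsub>G\<^esub> s = t [^]\<^bsub>G\<^esub> s \<otimes>\<^bsub>G\<^esub> t"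
    by (metis G.nat_pow_Suc G.nat_pow_Suc2 t_car)
  also have "cl (w c) \<otimes>\<^bsub>G\<^esub> (t [^]\<^bsub>G\<^esub> s \<otimes>\<^bsub>G\<^esub> t) = W \<otimes>\<^bsub>G\<^esub> t"
    by (simp add: W(2) G.m_assoc)
  finally have tW: "t \<otimes>\<^bsub>G\<^esub> W = W \<otimes>\<^bsub>G\<^esub> t" .
  \<comment> \<open>Here \<open>t a_c w_c = a_c t\<close> absorbs the \<open>w_c\<close> contained
    in \<open>W\<close>. The powers of \<open>t\<close> from \<open>b\<close> and \<open>W\<close>
    remain, with one more \<open>t\<close>, which is the 1 in \<open>1 + s\<close>.\<close>
  have "t \<otimes>\<^bsub>G\<^esub> b \<otimes>\<^bsub>G\<^esub> W
      = t \<otimes>\<^bsub>G\<^esub> a c \<otimes>\<^bsub>G\<^esub> (t [^]\<^bsub>G\<^esub> r c \<otimes>\<^bsub>G\<^esub> cl (w c)) \<otimes>\<^bsub>G\<^esub> t [^]\<^bsub>G\<^esub> s"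
    by (simp add: b_def W(2) G.m_assoc)
  also have "\<dots> = (t \<otimes>\<^bsub>G\<^esub> a c \<otimes>\<^bsub>G\<^esub> cl (w c)) \<otimes>\<^bsub>G\<^esub> (t [^]\<^bsub>G\<^esub> r c \<otimes>\<^bsub>G\<^esub> t [^]\<^bsub>G\<^esub> s)"
    by (simp add: tw G.m_assoc)
  also have "\<dots> = a c \<otimes>\<^bsub>G\<^esub> (t \<otimes>\<^bsub>G\<^esub> t [^]\<^bsub>G\<^esub> (r c + s))"
    by (simp only: rel[OF c w_car, symmetric] G.nat_pow_mult t_car G.m_assoc a_car[OF c] G.nat_pow_closed)
  also have "\<dots> = a c \<otimes>\<^bsub>G\<^esub> t [^]\<^bsub>G\<^esub> (r c + Suc s)"
    by (simp only: G.nat_pow_Suc2[OF t_car, symmetric] add_Suc_right)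
  also have "\<dots> = b \<otimes>\<^bsub>G\<^esub> t [^]\<^bsub>G\<^esub> Suc s"
    by (simp only: b_def G.nat_pow_mult[OF t_car, symmetric] G.m_assoc a_car[OF c] t_car G.nat_pow_closed)
  finally have tbW: "t \<otimes>\<^bsub>G\<^esub> b \<otimes>\<^bsub>G\<^esub> W = b \<otimes>\<^bsub>G\<^esub> t [^]\<^bsub>G\<^esub> Suc s" .
  note [simp] = HG.mem_carrier[OF b] HG.mem_carrier[OF W(1)]
  have "\<phi> t \<otimes>\<^bsub>Q\<^esub> inv\<^bsub>Q\<^esub> \<phi> b \<otimes>\<^bsub>Q\<^esub> \<phi> W \<otimes>\<^bsub>Q\<^esub> \<phi> b \<otimes>\<^bsub>Q\<^esub> inv\<^bsub>Q\<^esub> \<phi> t \<in> \<phi> ` H"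
  proof (rule H.conj_mem_of_finite[where u = "Suc s"])
    show "subgroup (\<phi> ` H) Q" by (rule subgroup_img_is_subgroup[OF H(1)])
    show "\<phi> t \<otimes>\<^bsub>Q\<^esub> \<phi> W = \<phi> W \<otimes>\<^bsub>Q\<^esub> \<phi> t"
      using arg_cong[OF tW, of \<phi>] by simp
    show "\<phi> t \<otimes>\<^bsub>Q\<^esub> \<phi> b \<otimes>\<^bsub>Q\<^esub> \<phi> W = \<phi> b \<otimes>\<^bsub>Q\<^esub> \<phi> t [^]\<^bsub>Q\<^esub> Suc s"
      using arg_cong[OF tbW, of \<phi>] by (simp add: hom_nat_pow del: G.nat_pow_Suc H.nat_pow_Suc)
  qed (use Q b W(1) in auto)
  moreover have "cl (witness_word w r c)
      = t \<otimes>\<^bsub>G\<^esub> inv\<^bsub>G\<^esub> b \<otimes>\<^bsub>G\<^esub> W \<otimes>\<^bsub>G\<^esub> b \<otimes>\<^bsub>G\<^esub> inv\<^bsub>G\<^esub> t"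
  proof -
    define v where "v = (A c, True) # replicate (r c) (T, True)"
    have v: "v \<in> gwords (Gk_gens k)" "b = cl v"
      using letters c by (simp_all add: v_def replicate_gwords b_def cl_Cons cl_T)
    have "inv\<^bsub>G\<^esub> t = cl [(T, False)]" using letters by (simp add: t_def cl_inv)
    then show ?thesis
      using v letters conjunct1[OF shifted[OF wc]]
      by (simp add: witness_word_def Let_def W_def t_def cl_inv cl_mult flip: v_def)
  qed
  ultimately have "\<phi> (cl (witness_word w r c)) \<in> \<phi> ` H" by simp
  then show ?thesis by (simp add: H_def cl_def)
qed

theorem theorem1p5:
  fixes k c :: nat and w :: "nat \<Rightarrow> letter gword" and r :: "nat \<Rightarrow> nat"
  assumes "k \<ge> 1"
    and "\<And>i. i \<in> {1..k} \<Longrightarrow> w i \<in> gwords (A ` {1..<i}) \<and> positive_word (w i)"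
    and "c \<in> {1..k}"
    and "\<And>i. i \<in> {1..<c} \<Longrightarrow> w i = []"
    and "w c \<noteq> []"
    and "(\<Sum>i = 1..c - 1. index_sum (A i) (w c) * int (r i)) \<noteq> 0"
  shows "subgroup (Hk k w r) (Gk k w) \<and> \<not> separable (Gk k w) (Hk k w r)"
proof
  define g where "g = witness_word w r c"
  define S where "S = (\<lambda>i. (A i, True) # replicate (r i) (T, True)) ` {1..k}"
  have S: "S \<subseteq> gwords (Gk_gens k)"
    by (auto simp: S_def Gk_gens_def replicate_gwords)
  have H: "Hk k w r = generate (Gk k w) (pres_class (Gk_gens k) (Gk_rels k w) ` S)"
    by (simp add: Hk_def S_def image_image)
  have "pres_class (Gk_gens k) (Gk_rels k w) ` S \<subseteq> carrier (Gk k w)"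
    using S by (auto simp: Gk_def pres_class_in_carrier)
  then show "subgroup (Hk k w r) (Gk k w)"
    unfolding H Gk_def by (rule group.generate_is_subgroup[OF group_presented_group])
  have wc: "w c \<in> gwords (A ` {1..<c})" "positive_word (w c)" using assms(2,3) by auto
  have "{1..<c} = {1..c - 1}" using assms(3) by auto
  then have wt: "T_weight r (w c) \<noteq> 0"
    using T_weight_index_sum[OF wc, of r] assms(6) by auto
  have g_gw: "g \<in> gwords (insert T (A ` {1..c}))"
    using witness_word_gwords[of w c, OF wc] assms(3) by (simp add: g_def)
  obtain \<rho>0 and z0 :: "int \<Rightarrow> nat" where "pointed_hydra_action w r c \<rho>0 z0"
    and "word_act \<rho>0 g (z0 0) \<noteq> z0 0"
    unfolding g_def by (rule pointed_hydra_action_first_stage[of c w r]) (use assms wt that in auto)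
  then obtain \<rho> and z :: "int \<Rightarrow> nat" where \<rho>: "pointed_hydra_action w r k \<rho> z"
    and gz: "word_act \<rho> g (z 0) \<noteq> z 0"
    using pointed_hydra_action_later_stage[of w r c \<rho>0 z0 g k] assms(2,3) g_gw by (auto simp: gwords_def)
  have bij: "bij (\<rho> x)" for x using \<rho> by (simp add: pointed_hydra_action_def hydra_action_def)
  have "pres_class (Gk_gens k) (Gk_rels k w) g \<notin> Hk k w r"
  proof
    assume "pres_class (Gk_gens k) (Gk_rels k w) g \<in> Hk k w r"
    then have gen: "pres_class (Gk_gens k) (Gk_rels k w) g
        \<in> generate (presented_group (Gk_gens k) (Gk_rels k w)) (pres_class (Gk_gens k) (Gk_rels k w) ` S)"
      by (simp add: H Gk_def)
    have "word_act \<rho> g (z 0) = z 0"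
    proof (rule generate_pres_class_fixes[OF S bij _ _ _ gen])
      show "word_act \<rho> l p = word_act \<rho> q p" if "(l, q) \<in> Gk_rels k w" for l q p
      proof -
        \<comment> \<open>The left side of a relation begins with \<open>t^-1\<close>, so the
          condition in \<open>hydra_action\<close> is used at the preimage of \<open>p\<close> under
          \<open>t\<close>.\<close>
        have "\<rho> T (inv_into UNIV (\<rho> T) p) = p"
          using bij by (simp add: bij_is_surj surj_f_inv_f)
        then show ?thesis
          using that \<rho> by (auto simp: Gk_rels_def word_conj_def pointed_hydra_action_def hydra_action_def)
      qed
      show "word_act \<rho> u (z 0) = z 0" if "u \<in> S" for u
        using that \<rho> word_act_replicate_T[of \<rho> T z]
        by (auto simp: S_def pointed_hydra_action_def)
      show "g \<in> gwords (Gk_gens k)"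
        using g_gw assms(3) by (force simp: gwords_def Gk_gens_def)
    qed
    then show False using gz by simp
  qed
  moreover have "pres_class (Gk_gens k) (Gk_rels k w) g \<in> carrier (Gk k w)"
    unfolding Gk_def using g_gw assms(3)
    by (intro pres_class_in_carrier) (force simp: gwords_def Gk_gens_def)
  \<comment> \<open>One and the same \<open>g\<close> works for every finite quotient, as the
    negation of \<open>separable\<close> demands.\<close>
  moreover have "\<phi> (pres_class (Gk_gens k) (Gk_rels k w) g) \<in> \<phi> ` Hk k w r"
    if "group Q" "finite (carrier Q)" "\<phi> \<in> epi (Gk k w) Q" for Q :: "nat monoid" and \<phi>
    unfolding g_def using that assms(3,4) wc
    by (intro witness_word_image_mem) (auto simp: epi_def)
  ultimately show "\<not> separable (Gk k w) (Hk k w r)"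
    unfolding separable_def by blast
qed

end
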